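(* Let $n=3$, so that $X=\{x\in\mathbb{R}^3:\|x\|_\infty=1\}$. Let $A=(1,a_y,a_z)\in X$ and $B=(b_x,1,b_z)\in X$. Then the geodesic distance between $A$ and $B$ is the minimum of the following three quantities: \[\alpha:=\max\{2-a_y-b_x,\ |a_z-b_z|\},\] \[\beta:=\max\{2-a_z-b_x,\ 2-a_y-b_z\},\] \[\gamma:=\max\{2+a_z-b_x,\ 2-a_y+b_z\}.\] The minimum is $\alpha$ if and only if at least one of the following four conditions is satisfied: (1) $|a_z|\le a_y$; (2) $|b_z|\le b_x$; (3) $|a_y|\le a_z$ and $|b_x|\le -b_z$; (4) $|a_y|\le -a_z$ and $|b_x|\le b_z$. The minimum is $\beta$ if and only if at least one of the following four conditions is satisfied: (5) $a_y\le a_z$ and $b_x\le b_z$ and $a_z\ge 0$ and $b_x\le a_y+a_z+b_z$; (6) $a_y\le a_z$ and $b_x\le b_z$ and $b_z\ge 0$ and $a_y\le b_x+a_z+b_z$; (7) $a_y=a_z=1$; (8) $b_x=b_z=1$. The minimum is $\gamma$ if and only if at least one of the following four conditions is satisfied: (9) $a_y\le -a_z$ and $b_x\le -b_z$ and $a_z\le 0$ and $b_x\le a_y-a_z-b_z$; (10) $a_y\le -a_z$ and $b_x\le -b_z$ and $b_z\le 0$ and $a_y\le b_x-a_z-b_z$; (11) $a_y=-a_z=1$; (12) $b_x=-b_z=1$. Moreover, there exists a planar minimal path joining $A$ and $B$.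
   Context: Let $X=\{x\in\mathbb{R}^n:\|x\|_\infty=1\}$ be the unit sphere of $\mathbb{R}^n$ with the sup norm $\|x\|_\infty=\max_i|x_i|$. The geodesic distance $d(A,B)$ between $A,B\in X$ is the one induced by the sup norm: the shortest arc length (measured with $\|\cdot\|_\infty$) among all curves lying on $X$ that join $A$ and $B$. A minimal (geodesic) path from $A$ to $B$ is a path on $X$ joining $A$ and $B$ whose length equals $d(A,B)$. The $(n-1)$-dimensional faces of $X$ are the sets $\{x\in X:x_i=1\}$ and $\{x\in X:x_i=-1\}$, $1\le i\le n$. Convention: only paths whose nonvoid intersection with each $(n-1)$-dimensional face is a line segment are considered, so every path from $A$ to $B$ is a finite sequence of line segments $AC_1,C_1C_2,\dots,C_mB$, where each $C_i$ lies in an $(n-2)$-dimensional face of $X$. A path is called planar if it is contained in an $(n-1)$-dimensional affine subspace of $\mathbb{R}^n$ (for $n=3$, a plane). "The minimum is $\alpha$" means $\min\{\alpha,\beta,\gamma\}=\alpha$ (ties allowed), and similarly for $\beta,\gamma$. *)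

theory Defs
  imports "HOL-Analysis.Analysis"
begin

definition sup_sphere :: "(real ^ 'n) set" where
  "sup_sphere = {x. infnorm x = 1}"

text \<open>The faces of \<^const>\<open>sup_sphere\<close> of dimension \<open>n - 1\<close> and \<open>n - 2\<close>.\<close>

definition facets :: "(real ^ 'n) set set" where
  "facets = {{x \<in> sup_sphere. x $ i = s} | i s. s \<in> {1, -1}}"

definition ridges :: "(real ^ 'n) set set" where
  "ridges = {{x \<in> sup_sphere. x $ i = s \<and> x $ j = t} | i j s t.
     i \<noteq> j \<and> s \<in> {1, -1} \<and> t \<in> {1, -1}}"

text \<open>Arc length with respect to the sup norm: the total variation of the curve over \<open>[0, 1]\<close>,
  infinite if the curve is not rectifiable.\<close>

definition sup_length :: "(real \<Rightarrow> real ^ 'n) \<Rightarrow> ereal" where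
  "sup_length g = (SUP ts \<in> {ts. sorted ts \<and> set ts \<subseteq> {0..1}}.
     ereal (\<Sum>i<length ts - 1. infnorm (g (ts ! Suc i) - g (ts ! i))))"

text \<open>The infimum is over all continuous curves on the sphere, polygonal or not.\<close>

definition geodesic_dist :: "real ^ 'n \<Rightarrow> real ^ 'n \<Rightarrow> ereal" where
  "geodesic_dist A B = (INF g \<in> {g. path g \<and> path_image g \<subseteq> sup_sphere \<and>
     pathstart g = A \<and> pathfinish g = B}. sup_length g)"

fun polygonal_path :: "'a::real_normed_vector list \<Rightarrow> real \<Rightarrow> 'a" where
  "polygonal_path [] = (\<lambda>_. 0)"
| "polygonal_path [p] = linepath p p"
| "polygonal_path [p, q] = linepath p q"
| "polygonal_path (p # q # r # ps) = linepath p q +++ polygonal_path (q # r # ps)"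

text \<open>A line segment may degenerate to a point: a path may touch a facet in a single point.\<close>

definition segmental_path :: "real ^ 'n \<Rightarrow> real ^ 'n \<Rightarrow> (real \<Rightarrow> real ^ 'n) \<Rightarrow> bool" where
  "segmental_path A B g \<longleftrightarrow>
     path_image g \<subseteq> sup_sphere \<and>
     (\<exists>Cs. g = polygonal_path (A # Cs @ [B]) \<and> (\<forall>C \<in> set Cs. \<exists>E \<in> ridges. C \<in> E)) \<and>
     (\<forall>F \<in> facets. path_image g \<inter> F = {} \<or> (\<exists>p q. path_image g \<inter> F = closed_segment p q))"

definition minimal_path :: "real ^ 'n \<Rightarrow> real ^ 'n \<Rightarrow> (real \<Rightarrow> real ^ 'n) \<Rightarrow> bool" where
  "minimal_path A B g \<longleftrightarrow> segmental_path A B g \<and> sup_length g = geodesic_dist A B"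

definition planar_path :: "(real \<Rightarrow> real ^ 'n) \<Rightarrow> bool" where
  "planar_path g \<longleftrightarrow>
     (\<exists>H. affine H \<and> aff_dim H = int CARD('n) - 1 \<and> path_image g \<subseteq> H)"

end

theory Submission
  imports Defs
begin

text \<open>The value \<open>\<alpha>\<close> is the distance from \<open>A\<close> to \<open>B\<close> inside the facets \<open>x = 1\<close> and \<open>y = 1\<close>; whenever \<open>\<beta>\<close> or
  \<open>\<gamma>\<close> is smaller than \<open>\<alpha>\<close>, it is the length of a shortest path crossing the facet \<open>z = 1\<close> or \<open>z = -1\<close>,
  respectively, in between. That no curve on the sphere, of whatever itinerary, is shorter than the minimum
  of the three is shown by potentials: a function on the sphere that is 1-Lipschitz for the sup norm
  on each facet changes along any curve by at most the length of the curve, as the curve can be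
  replaced by a polygon visiting each facet at most once (\<open>facewise_lipschitz_le_length\<close>). Two explicit
  piecewise affine potentials, one of them with a parameter, their images under symmetries of the
  cube, and the coordinate \<open>z\<close> give five lower bounds for the length, which together imply that it
  is at least \<open>\<alpha>\<close>, \<open>\<beta>\<close> or \<open>\<gamma>\<close> (\<open>min_le_sup_length\<close>).

  Paths of these lengths are written down explicitly. If \<open>\<alpha>\<close> is least, the path is straight in the
  unfolding of two facets, and it is planar because it has at most three vertices
  (\<open>planar_path_two_facets\<close>). If \<open>\<beta>\<close> or \<open>\<gamma>\<close> is least and smaller than \<open>\<alpha>\<close>, the path has two
  intermediate vertices on ridges, each with one degree of freedom.
  Optimal paths are far from unique for the sup norm, and this freedom suffices to make the four vertices
  coplanar (\<open>planar_path_three_facets_length\<close>).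

  The criteria for each of the quantities to be least are linear arithmetic over the box \<open>[-1, 1]^4\<close>.\<close>

section \<open>Lower bounds for arc length from potentials\<close>

text \<open>The length of the polygon with vertices on the curve at the parameters in the list; arc length is
  the supremum of these sums over sorted lists in \<open>[0, 1]\<close>.\<close>

definition chord_sum :: "(real \<Rightarrow> real ^ 'n) \<Rightarrow> real list \<Rightarrow> real" where
  "chord_sum g ts = (\<Sum>i<length ts - 1. infnorm (g (ts ! Suc i) - g (ts ! i)))"

lemma chord_sum_Cons_Cons:
  "chord_sum g (s # t # ts) = infnorm (g t - g s) + chord_sum g (t # ts)"
  by (simp add: chord_sum_def sum.lessThan_Suc_shift del: sum.lessThan_Suc)

lemma chord_sum_le_sup_length:
  assumes "sorted ts" "set ts \<subseteq> {0..1}"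
  shows "ereal (chord_sum g ts) \<le> sup_length g"
  unfolding sup_length_def chord_sum_def using assms by (intro SUP_upper) auto

text \<open>A function that is 1-Lipschitz on each of finitely many closed sets covering the curve changes by
  at most the length of an inscribed polygon. From the current point, lying in \<open>F\<close>, jump to the last
  time at which the curve is in \<open>F\<close>: the curve never meets \<open>F\<close> again, so the remaining sets cover the
  rest, including the jump target because they are closed. Hence the induction on their number.\<close>

lemma chord_sum_facewise_lipschitz:
  fixes g :: "real \<Rightarrow> real ^ 'n" and f :: "real ^ 'n \<Rightarrow> real"
  assumes g: "continuous_on {0..1} g"
    and "finite \<F>"
    and closed: "\<And>F. F \<in> \<F> \<Longrightarrow> closed F"
    and lip: "\<And>F P Q. F \<in> \<F> \<Longrightarrow> P \<in> F \<Longrightarrow> Q \<in> F \<Longrightarrow> \<bar>f P - f Q\<bar> \<le> infnorm (P - Q)"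
    and s: "0 \<le> s" "s \<le> 1"
    and cover: "g ` {s..1} \<subseteq> \<Union>\<F>"
  shows "\<exists>ts. sorted (s # ts) \<and> set (s # ts) \<subseteq> {0..1} \<and> \<bar>f (g 1) - f (g s)\<bar> \<le> chord_sum g (s # ts)"
  using assms(2) closed lip s cover
proof (induction \<F> arbitrary: s rule: measure_induct_rule[of card])
  case (less \<F>)
  obtain F where F: "F \<in> \<F>" "g s \<in> F"
    using less.prems(5,6) by force
  define T where "T = {s..1} \<inter> g -` F"
  have "continuous_on {s..1} g"
    using g less.prems(4) by (auto intro: continuous_on_subset)
  then have "closed T"
    unfolding T_def using less.prems(2)[OF F(1)] by (intro continuous_closed_preimage) auto
  have "compact T"
    using \<open>closed T\<close> by (metis T_def compact_Icc compact_Int_closed inf.right_idem inf_commute inf_left_commute)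
  moreover have "s \<in> T"
    using F less.prems(5) by (auto simp: T_def)
  ultimately obtain t where t: "t \<in> T" "\<And>t'. t' \<in> T \<Longrightarrow> t' \<le> t"
    using compact_attains_sup[of T] by auto
  have st: "s \<le> t" "t \<le> 1" "g t \<in> F"
    using t(1) by (auto simp: T_def)
  have step: "\<bar>f (g t) - f (g s)\<bar> \<le> infnorm (g t - g s)"
    using less.prems(3)[OF F(1)] F(2) st by blast
  show ?case
  proof (cases "t = 1")
    case True
    then show ?thesis
      using step less.prems(4,5) by (intro exI[of _ "[1]"]) (auto simp: chord_sum_def)
  next
    case False
    have closed': "closed (\<Union>(\<F> - {F}))"
      using less.prems(1,2) by (intro closed_Union) auto
    have "g ` {t<..1} \<subseteq> \<Union>(\<F> - {F})"
    proof (intro image_subsetI)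
      fix r assume r: "r \<in> {t<..1}"
      then have "r \<in> {s..1}"
        using st by auto
      then obtain F' where "F' \<in> \<F>" "g r \<in> F'"
        using less.prems(6) by blast
      moreover have "g r \<notin> F"
        using t(2)[of r] r \<open>r \<in> {s..1}\<close> by (auto simp: T_def)
      ultimately show "g r \<in> \<Union>(\<F> - {F})"
        by blast
    qed
    moreover have "closure {t<..1} = {t..1}"
      using False st by (intro closure_greaterThanAtMost) auto
    moreover have "continuous_on {t..1} g"
      using g less.prems(4) st by (auto intro: continuous_on_subset)
    ultimately have "g ` {t..1} \<subseteq> \<Union>(\<F> - {F})"
      using closed' image_closure_subset[of "{t<..1}" g "\<Union>(\<F> - {F})"] by auto
    moreover have "card (\<F> - {F}) < card \<F>"
      using less.prems(1) F(1) by (meson card_Diff1_less)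
    ultimately have "\<exists>ts. sorted (t # ts) \<and> set (t # ts) \<subseteq> {0..1} \<and>
        \<bar>f (g 1) - f (g t)\<bar> \<le> chord_sum g (t # ts)"
      using less.prems(1-4) st by (intro less.IH[of "\<F> - {F}" t]) auto
    then obtain ts where ts: "sorted (t # ts)" "set (t # ts) \<subseteq> {0..1}"
      "\<bar>f (g 1) - f (g t)\<bar> \<le> chord_sum g (t # ts)"
      by blast
    show ?thesis
    proof (intro exI[of _ "t # ts"] conjI)
      show "sorted (s # t # ts)" "set (s # t # ts) \<subseteq> {0..1}"
        using ts st less.prems(4) by auto
      show "\<bar>f (g 1) - f (g s)\<bar> \<le> chord_sum g (s # t # ts)"
        using ts(3) step by (simp add: chord_sum_Cons_Cons)
    qed
  qed
qed

lemma facewise_lipschitz_le_sup_length: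
  fixes g :: "real \<Rightarrow> real ^ 'n" and f :: "real ^ 'n \<Rightarrow> real"
  assumes g: "path g" "path_image g \<subseteq> \<Union>\<F>"
    and "finite \<F>" "\<And>F. F \<in> \<F> \<Longrightarrow> closed F"
    and "\<And>F P Q. F \<in> \<F> \<Longrightarrow> P \<in> F \<Longrightarrow> Q \<in> F \<Longrightarrow> \<bar>f P - f Q\<bar> \<le> infnorm (P - Q)"
  shows "ereal \<bar>f (pathfinish g) - f (pathstart g)\<bar> \<le> sup_length g"
proof -
  obtain ts where "sorted (0 # ts)" "set (0 # ts) \<subseteq> {0..1}"
    "\<bar>f (g 1) - f (g 0)\<bar> \<le> chord_sum g (0 # ts)"
    using chord_sum_facewise_lipschitz[of g \<F> f 0] assms
    by (auto simp: path_def path_image_def)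
  then show ?thesis
    using chord_sum_le_sup_length[of "0 # ts" g]
    by (auto simp: pathstart_def pathfinish_def intro: order_trans[rotated])
qed

section \<open>Upper bounds for arc length\<close>

text \<open>A certificate for arc length at most \<open>l\<close>: a function \<open>L\<close> whose increments dominate the
  displacements of the curve. Unlike a supremum over lists, it is easily glued when paths are joined.\<close>

definition length_bounded :: "(real \<Rightarrow> real ^ 'n) \<Rightarrow> real \<Rightarrow> bool" where
  "length_bounded g l \<longleftrightarrow> (\<exists>L. L 0 = 0 \<and> L 1 = l \<and>
     (\<forall>s t. 0 \<le> s \<and> s \<le> t \<and> t \<le> 1 \<longrightarrow> infnorm (g t - g s) \<le> L t - L s))"

lemma sup_length_le_if_length_bounded:
  assumes "length_bounded g l"
  shows "sup_length g \<le> ereal l"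
proof -
  obtain L where L: "L 0 = 0" "L 1 = l"
    "\<And>s t. 0 \<le> s \<Longrightarrow> s \<le> t \<Longrightarrow> t \<le> 1 \<Longrightarrow> infnorm (g t - g s) \<le> L t - L s"
    using assms unfolding length_bounded_def by blast
  have mono: "L s \<le> L t" if "0 \<le> s" "s \<le> t" "t \<le> 1" for s t
    using L(3)[OF that] infnorm_pos_le[of "g t - g s"] by linarith
  have *: "chord_sum g (s # ts) \<le> l - L s" if "sorted (s # ts)" "set (s # ts) \<subseteq> {0..1}" for s ts
    using that
  proof (induction ts arbitrary: s)
    case Nil
    then show ?case
      using mono[of s 1] L(2) by (simp add: chord_sum_def)
  next
    case (Cons t ts)
    then have "chord_sum g (t # ts) \<le> l - L t"
      by simp
    moreover have "infnorm (g t - g s) \<le> L t - L s"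
      using Cons.prems by (intro L(3)) auto
    ultimately show ?case
      by (simp add: chord_sum_Cons_Cons)
  qed
  have "chord_sum g ts \<le> l" if "sorted ts" "set ts \<subseteq> {0..1}" for ts
  proof (cases ts)
    case Nil
    then show ?thesis
      using mono[of 0 1] L by (simp add: chord_sum_def)
  next
    case (Cons s ts')
    then show ?thesis
      using *[of s ts'] mono[of 0 s] L(1) that by auto
  qed
  then show ?thesis
    unfolding sup_length_def chord_sum_def by (intro SUP_least) auto
qed

lemma length_bounded_linepath: "length_bounded (linepath p q) (infnorm (q - p))"
  unfolding length_bounded_def
proof (intro exI[of _ "\<lambda>t. t * infnorm (q - p)"] conjI allI impI)
  fix s t :: real assume st: "0 \<le> s \<and> s \<le> t \<and> t \<le> 1"
  have *: "linepath p q t - linepath p q s = (t - s) *\<^sub>R (q - p)"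
    by (simp add: linepath_def algebra_simps)
  then show "infnorm (linepath p q t - linepath p q s) \<le> t * infnorm (q - p) - s * infnorm (q - p)"
    using st by (simp add: * infnorm_mul left_diff_distrib)
qed auto

lemma length_bounded_join:
  assumes "length_bounded g k" "length_bounded h l" "pathfinish g = pathstart h"
  shows "length_bounded (g +++ h) (k + l)"
proof -
  obtain K where K: "K 0 = 0" "K 1 = k"
    "\<And>s t. 0 \<le> s \<Longrightarrow> s \<le> t \<Longrightarrow> t \<le> 1 \<Longrightarrow> infnorm (g t - g s) \<le> K t - K s"
    using assms(1) unfolding length_bounded_def by blast
  obtain L where L: "L 0 = 0" "L 1 = l"
    "\<And>s t. 0 \<le> s \<Longrightarrow> s \<le> t \<Longrightarrow> t \<le> 1 \<Longrightarrow> infnorm (h t - h s) \<le> L t - L s"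
    using assms(2) unfolding length_bounded_def by blast
  define M where "M t = (if t \<le> 1/2 then K (2 * t) else k + L (2 * t - 1))" for t
  have "infnorm ((g +++ h) t - (g +++ h) s) \<le> M t - M s" if st: "0 \<le> s" "s \<le> t" "t \<le> 1" for s t
  proof -
    consider "t \<le> 1/2" | "s > 1/2" | "s \<le> 1/2" "t > 1/2"
      by linarith
    then show ?thesis
    proof cases
      case 1
      then show ?thesis
        using K(3)[of "2 * s" "2 * t"] st by (simp add: M_def joinpaths_def)
    next
      case 2
      then show ?thesis
        using L(3)[of "2 * s - 1" "2 * t - 1"] st by (simp add: M_def joinpaths_def)
    next
      case 3
      have "(g +++ h) t - (g +++ h) s = (h (2 * t - 1) - h 0) + (g 1 - g (2 * s))"
        using 3 assms(3) by (simp add: joinpaths_def pathfinish_def pathstart_def)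
      then have "infnorm ((g +++ h) t - (g +++ h) s)
          \<le> infnorm (h (2 * t - 1) - h 0) + infnorm (g 1 - g (2 * s))"
        by (metis infnorm_triangle)
      also have "\<dots> \<le> (L (2 * t - 1) - L 0) + (K 1 - K (2 * s))"
        using 3 st by (intro add_mono L(3) K(3)) auto
      finally show ?thesis
        using 3 K L by (simp add: M_def)
    qed
  qed
  moreover have "M 0 = 0" "M 1 = k + l"
    using K L by (auto simp: M_def)
  ultimately show ?thesis
    unfolding length_bounded_def by blast
qed

section \<open>Two potentials on the surface of the cube\<close>

lemma infnorm_le_cart:
  fixes x :: "real ^ 'n"
  shows "infnorm x \<le> d \<longleftrightarrow> (\<forall>i. \<bar>x $ i\<bar> \<le> d)"
proof
  show "\<forall>i. \<bar>x $ i\<bar> \<le> d" if "infnorm x \<le> d"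
    using that component_le_infnorm_cart order_trans by blast
  show "infnorm x \<le> d" if "\<forall>i. \<bar>x $ i\<bar> \<le> d"
    unfolding infnorm_cart using that by (intro cSup_least) auto
qed

lemma infnorm_3:
  fixes x :: "real ^ 3"
  shows "infnorm x = max \<bar>x $ 1\<bar> (max \<bar>x $ 2\<bar> \<bar>x $ 3\<bar>)"
  by (rule antisym) (auto simp: infnorm_le_cart forall_3 component_le_infnorm_cart)

text \<open>The function \<open>\<phi>\<close> of three coordinates is 1-Lipschitz for the sup norm on each of the six facets of the
  cube \<open>[-1, 1]^3\<close>; \<open>u\<close> and \<open>v\<close> are the two free coordinates on a facet. Nothing is required of
  two points in different facets.\<close>

definition facewise_lipschitz :: "(real \<Rightarrow> real \<Rightarrow> real \<Rightarrow> real) \<Rightarrow> bool" where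
  "facewise_lipschitz \<phi> \<longleftrightarrow>
     (\<forall>s\<in>{1, -1}. \<forall>u\<in>{-1..1}. \<forall>v\<in>{-1..1}. \<forall>u'\<in>{-1..1}. \<forall>v'\<in>{-1..1}. \<forall>d.
        \<bar>u - u'\<bar> \<le> d \<longrightarrow> \<bar>v - v'\<bar> \<le> d \<longrightarrow>
          \<bar>\<phi> s u v - \<phi> s u' v'\<bar> \<le> d \<and> \<bar>\<phi> u s v - \<phi> u' s v'\<bar> \<le> d \<and> \<bar>\<phi> u v s - \<phi> u' v' s\<bar> \<le> d)"

lemma facewise_lipschitzI:
  assumes "\<And>s u v u' v' d. s = 1 \<or> s = -1 \<Longrightarrow> u \<in> {-1..1} \<Longrightarrow> v \<in> {-1..1} \<Longrightarrow> u' \<in> {-1..1} \<Longrightarrow> v' \<in> {-1..1}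
      \<Longrightarrow> \<bar>u - u'\<bar> \<le> d \<Longrightarrow> \<bar>v - v'\<bar> \<le> d \<Longrightarrow>
     \<bar>\<phi> s u v - \<phi> s u' v'\<bar> \<le> d \<and> \<bar>\<phi> u s v - \<phi> u' s v'\<bar> \<le> d \<and> \<bar>\<phi> u v s - \<phi> u' v' s\<bar> \<le> d"
  shows "facewise_lipschitz \<phi>"
  unfolding facewise_lipschitz_def using assms by blast

lemma facewise_lipschitzD:
  assumes "facewise_lipschitz \<phi>" "s = 1 \<or> s = -1" "u \<in> {-1..1}" "v \<in> {-1..1}" "u' \<in> {-1..1}" "v' \<in> {-1..1}"
    "\<bar>u - u'\<bar> \<le> d" "\<bar>v - v'\<bar> \<le> d"
  shows "\<bar>\<phi> s u v - \<phi> s u' v'\<bar> \<le> d" "\<bar>\<phi> u s v - \<phi> u' s v'\<bar> \<le> d" "\<bar>\<phi> u v s - \<phi> u' v' s\<bar> \<le> d"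
  using assms unfolding facewise_lipschitz_def by blast+

lemma facewise_lipschitz_reflect:
  assumes "facewise_lipschitz \<phi>"
  shows "facewise_lipschitz (\<lambda>x y z. \<phi> x y (- z))"
proof (rule facewise_lipschitzI)
  fix s u v u' v' d :: real
  assume *: "s = 1 \<or> s = -1" "u \<in> {-1..1}" "v \<in> {-1..1}" "u' \<in> {-1..1}" "v' \<in> {-1..1}"
    "\<bar>u - u'\<bar> \<le> d" "\<bar>v - v'\<bar> \<le> d"
  then have "- s = 1 \<or> - s = -1" "- v \<in> {-1..1}" "- v' \<in> {-1..1}" "\<bar>- v - - v'\<bar> \<le> d"
    by auto
  then show "\<bar>\<phi> s u (- v) - \<phi> s u' (- v')\<bar> \<le> d \<and> \<bar>\<phi> u s (- v) - \<phi> u' s (- v')\<bar> \<le> d \<and>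
      \<bar>\<phi> u v (- s) - \<phi> u' v' (- s)\<bar> \<le> d"
    using * by (intro conjI facewise_lipschitzD[OF assms])
qed

lemma facewise_lipschitz_swap:
  assumes "facewise_lipschitz \<phi>"
  shows "facewise_lipschitz (\<lambda>x y z. \<phi> y x z)"
  using assms unfolding facewise_lipschitz_def by blast

lemma facewise_lipschitz_third: "facewise_lipschitz (\<lambda>x y z. z)"
  by (rule facewise_lipschitzI) auto

lemma abs_max_diff_le:
  fixes a b a' b' d :: real
  shows "\<bar>a - a'\<bar> \<le> d \<Longrightarrow> \<bar>b - b'\<bar> \<le> d \<Longrightarrow> \<bar>max a b - max a' b'\<bar> \<le> d"
  by linarith

lemma abs_min_diff_le:
  fixes a b a' b' d :: real
  shows "\<bar>a - a'\<bar> \<le> d \<Longrightarrow> \<bar>b - b'\<bar> \<le> d \<Longrightarrow> \<bar>min a b - min a' b'\<bar> \<le> d"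
  by linarith

text \<open>This potential equals \<open>max y \<bar>z\<bar> - 1\<close> on the facet \<open>x = 1\<close> and \<open>1 - x\<close> on the facet \<open>y = 1\<close>. On the former
  its negative measures how far a point is from leaving the facet through one of the edges \<open>y = 1\<close>,
  \<open>z = 1\<close>, \<open>z = -1\<close>; after that, the coordinate \<open>x\<close> still has to decrease. On the other facets the
  values fit together along the ridges, so that the order of the case distinction is irrelevant.\<close>

definition exit_pot :: "real \<Rightarrow> real \<Rightarrow> real \<Rightarrow> real" where
  "exit_pot x y z =
    (if x = 1 then max (y - 1) (\<bar>z\<bar> - 1)
     else if x = -1 then max 1 (1 + y)
     else if y = 1 then 1 - x
     else if y = -1 then max (- x) (\<bar>z\<bar> - 1)
     else min (1 - x) (max (- x) (1 + y)))"

lemma exit_pot_faces: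
  shows "exit_pot 1 y z = max (y - 1) (\<bar>z\<bar> - 1)"
    and "exit_pot (-1) y z = max 1 (1 + y)"
    and "x \<in> {-1..1} \<Longrightarrow> z \<in> {-1..1} \<Longrightarrow> exit_pot x 1 z = 1 - x"
    and "x \<in> {-1..1} \<Longrightarrow> z \<in> {-1..1} \<Longrightarrow> exit_pot x (-1) z = max (- x) (\<bar>z\<bar> - 1)"
    and "x \<in> {-1..1} \<Longrightarrow> y \<in> {-1..1} \<Longrightarrow> exit_pot x y 1 = min (1 - x) (max (- x) (1 + y))"
    and "x \<in> {-1..1} \<Longrightarrow> y \<in> {-1..1} \<Longrightarrow> exit_pot x y (-1) = min (1 - x) (max (- x) (1 + y))"
  unfolding exit_pot_def by (simp_all split: if_split) linarith+

lemma facewise_lipschitz_exit_pot: "facewise_lipschitz exit_pot"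
proof (rule facewise_lipschitzI)
  fix s u v u' v' d :: real
  assume *: "s = 1 \<or> s = -1" "u \<in> {-1..1}" "v \<in> {-1..1}" "u' \<in> {-1..1}" "v' \<in> {-1..1}"
    and d: "\<bar>u - u'\<bar> \<le> d" "\<bar>v - v'\<bar> \<le> d"
  note faces = exit_pot_faces(1,2) exit_pot_faces(3-)[OF *(2,3)] exit_pot_faces(3-)[OF *(4,5)]
  show "\<bar>exit_pot s u v - exit_pot s u' v'\<bar> \<le> d \<and> \<bar>exit_pot u s v - exit_pot u' s v'\<bar> \<le> d \<and>
      \<bar>exit_pot u v s - exit_pot u' v' s\<bar> \<le> d"
    using *(1) d
    by (elim disjE; hypsubst; unfold faces; intro conjI; (intro abs_max_diff_le abs_min_diff_le)?; linarith)
qed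

text \<open>This potential separates the terms \<open>2 - a\<^sub>z - b\<^sub>x\<close> and \<open>2 - a\<^sub>y + b\<^sub>z\<close>, which belong to different ones of the
  three competing maxima. The shift \<open>k\<close> is to be \<open>max 0 (a\<^sub>z - a\<^sub>y)\<close>, which gives the potential
  the value \<open>a\<^sub>y - 1\<close> at \<open>(1, a\<^sub>y, a\<^sub>z)\<close>. If
  \<open>0 \<le> k \<le> 2\<close>, the values fit together along the ridges, as before.\<close>

definition mixed_pot :: "real \<Rightarrow> real \<Rightarrow> real \<Rightarrow> real \<Rightarrow> real" where
  "mixed_pot k x y z =
    (if x = 1 then max (y - 1) (z - 1 - k)
     else if x = -1 then max 0 (min (y + 1 - k) (z + 1))
     else if y = 1 then max 0 (min (1 - x - k) (1 + z))
     else if y = -1 then max (- 1 - x) (z - 1 - k)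
     else if z = 1 then min (max (y - 1) (1 - x - k)) (max (y + 1 - k) (- 1 - x))
     else max (y - 1) (- 1 - x))"

lemma mixed_pot_faces:
  fixes k :: real
  assumes "0 \<le> k" "k \<le> 2"
  shows "mixed_pot k 1 y z = max (y - 1) (z - 1 - k)"
    and "mixed_pot k (-1) y z = max 0 (min (y + 1 - k) (z + 1))"
    and "x \<in> {-1..1} \<Longrightarrow> z \<in> {-1..1} \<Longrightarrow> mixed_pot k x 1 z = max 0 (min (1 - x - k) (1 + z))"
    and "x \<in> {-1..1} \<Longrightarrow> z \<in> {-1..1} \<Longrightarrow> mixed_pot k x (-1) z = max (- 1 - x) (z - 1 - k)"
    and "x \<in> {-1..1} \<Longrightarrow> y \<in> {-1..1} \<Longrightarrow> mixed_pot k x y 1 = min (max (y - 1) (1 - x - k)) (max (y + 1 - k) (- 1 - x))"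
    and "x \<in> {-1..1} \<Longrightarrow> y \<in> {-1..1} \<Longrightarrow> mixed_pot k x y (-1) = max (y - 1) (- 1 - x)"
  using assms unfolding mixed_pot_def by (simp_all split: if_split) linarith+

lemma facewise_lipschitz_mixed_pot:
  assumes "0 \<le> k" "k \<le> 2"
  shows "facewise_lipschitz (mixed_pot k)"
proof (rule facewise_lipschitzI)
  fix s u v u' v' d :: real
  assume *: "s = 1 \<or> s = -1" "u \<in> {-1..1}" "v \<in> {-1..1}" "u' \<in> {-1..1}" "v' \<in> {-1..1}"
    and d: "\<bar>u - u'\<bar> \<le> d" "\<bar>v - v'\<bar> \<le> d"
  note faces = mixed_pot_faces(1,2)[OF assms] mixed_pot_faces(3-)[OF assms *(2,3)] mixed_pot_faces(3-)[OF assms *(4,5)]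
  show "\<bar>mixed_pot k s u v - mixed_pot k s u' v'\<bar> \<le> d \<and> \<bar>mixed_pot k u s v - mixed_pot k u' s v'\<bar> \<le> d \<and>
      \<bar>mixed_pot k u v s - mixed_pot k u' v' s\<bar> \<le> d"
    using *(1) d
    by (elim disjE; hypsubst; unfold faces; intro conjI; (intro abs_max_diff_le abs_min_diff_le)?; linarith)
qed

section \<open>The lower bound for the distance\<close>

lemma sup_sphere_component_le:
  "P \<in> sup_sphere \<Longrightarrow> \<bar>P $ i\<bar> \<le> 1"
  using component_le_infnorm_cart[of P i] by (simp add: sup_sphere_def)

lemma sup_sphere_eq_Union_facets: "(sup_sphere :: (real ^ 'n) set) = \<Union>facets"
proof
  show "(sup_sphere :: (real ^ 'n) set) \<subseteq> \<Union>facets"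
  proof
    fix P :: "real ^ 'n" assume P: "P \<in> sup_sphere"
    have "infnorm P \<in> (\<lambda>b. \<bar>P \<bullet> b\<bar>) ` Basis"
      unfolding infnorm_Max by (rule Max_in) auto
    then obtain i where "\<bar>P $ i\<bar> = 1"
      using P by (auto simp: sup_sphere_def Basis_vec_def inner_axis)
    then have "P $ i = 1 \<or> P $ i = -1"
      by linarith
    then show "P \<in> \<Union>facets"
      using P by (auto simp: facets_def)
  qed
qed (auto simp: facets_def)

lemma finite_facets: "finite (facets :: (real ^ 'n) set set)"
proof -
  have "facets = (\<lambda>(i :: 'n, s). {x \<in> sup_sphere. x $ i = s}) ` (UNIV \<times> {1, -1})"
    by (auto simp: facets_def)
  then show ?thesis
    by (rule ssubst) (intro finite_imageI finite_cartesian_product; simp)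
qed

lemma closed_facet:
  assumes "F \<in> facets"
  shows "closed F"
proof -
  obtain i s where F: "F = {x. infnorm x = 1} \<inter> {x. x $ i = s}"
    using assms by (auto simp: facets_def sup_sphere_def)
  show ?thesis
    unfolding F by (intro closed_Int closed_Collect_eq continuous_intros)
qed

lemma facewise_lipschitz_le_length:
  fixes g :: "real \<Rightarrow> real ^ 3"
  assumes "facewise_lipschitz \<phi>" "path g" "path_image g \<subseteq> sup_sphere"
    "pathstart g = A" "pathfinish g = B"
  shows "ereal \<bar>\<phi> (B $ 1) (B $ 2) (B $ 3) - \<phi> (A $ 1) (A $ 2) (A $ 3)\<bar> \<le> sup_length g"
proof -
  have "\<bar>\<phi> (P $ 1) (P $ 2) (P $ 3) - \<phi> (Q $ 1) (Q $ 2) (Q $ 3)\<bar> \<le> infnorm (P - Q)"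
    if F: "F \<in> facets" "P \<in> F" "Q \<in> F" for F and P Q :: "real ^ 3"
  proof -
    obtain i s where i: "s = 1 \<or> s = -1" "P $ i = s" "Q $ i = s" "P \<in> sup_sphere" "Q \<in> sup_sphere"
      using F by (auto simp: facets_def)
    have "R $ j \<in> {-1..1}" if "R \<in> sup_sphere" for R :: "real ^ 3" and j
      using sup_sphere_component_le[OF that, of j] by (simp add: abs_le_iff)
    then have "P $ j \<in> {-1..1}" "Q $ j \<in> {-1..1}" "\<bar>P $ j - Q $ j\<bar> \<le> infnorm (P - Q)" for j
      using i component_le_infnorm_cart[of "P - Q" j] by (simp_all del: atLeastAtMost_iff)
    note * = facewise_lipschitzD[OF assms(1) i(1) this(1,1,2,2,3,3)]
    show ?thesis
      using exhaust_3[of i] *(1)[of 2 3] *(2)[of 1 3] *(3)[of 1 2] i(2,3) by auto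
  qed
  then show ?thesis
    using facewise_lipschitz_le_sup_length[of g facets "\<lambda>P. \<phi> (P $ 1) (P $ 2) (P $ 3)"] assms
    by (auto simp: finite_facets closed_facet simp flip: sup_sphere_eq_Union_facets)
qed

text \<open>The minimum of the three maxima is the largest of the minima over all choices of one term from each
  maximum. The first four assumptions cover the choices with \<open>2 - a\<^sub>y - b\<^sub>x\<close>, the last one those with
  \<open>\<bar>a\<^sub>z - b\<^sub>z\<bar>\<close>.\<close>

lemma some_max_le_if_bounds:
  fixes a\<^sub>y a\<^sub>z b\<^sub>x b\<^sub>z l :: real
  assumes "2 - b\<^sub>x - max a\<^sub>y \<bar>a\<^sub>z\<bar> \<le> l"
    "2 - a\<^sub>y - max b\<^sub>x \<bar>b\<^sub>z\<bar> \<le> l"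
    "min (2 - max a\<^sub>y a\<^sub>z - b\<^sub>x) (2 - a\<^sub>y + b\<^sub>z) \<le> l"
    "min (2 - max a\<^sub>y (- a\<^sub>z) - b\<^sub>x) (2 - a\<^sub>y - b\<^sub>z) \<le> l"
    "\<bar>a\<^sub>z - b\<^sub>z\<bar> \<le> l"
  shows "max (2 - a\<^sub>y - b\<^sub>x) \<bar>a\<^sub>z - b\<^sub>z\<bar> \<le> l
     \<or> max (2 - a\<^sub>z - b\<^sub>x) (2 - a\<^sub>y - b\<^sub>z) \<le> l
     \<or> max (2 + a\<^sub>z - b\<^sub>x) (2 - a\<^sub>y + b\<^sub>z) \<le> l"
  using assms by (smt (verit))

lemma min_le_sup_length:
  fixes g :: "real \<Rightarrow> real ^ 3"
  assumes g: "path g" "path_image g \<subseteq> sup_sphere"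
    "pathstart g = vector [1, a\<^sub>y, a\<^sub>z]" "pathfinish g = vector [b\<^sub>x, 1, b\<^sub>z]"
  shows "ereal (min (max (2 - a\<^sub>y - b\<^sub>x) \<bar>a\<^sub>z - b\<^sub>z\<bar>)
    (min (max (2 - a\<^sub>z - b\<^sub>x) (2 - a\<^sub>y - b\<^sub>z)) (max (2 + a\<^sub>z - b\<^sub>x) (2 - a\<^sub>y + b\<^sub>z))))
    \<le> sup_length g"
proof (rule ereal_le_real)
  fix l assume "sup_length g \<le> ereal l"
  then have le: "\<bar>\<phi> b\<^sub>x 1 b\<^sub>z - \<phi> 1 a\<^sub>y a\<^sub>z\<bar> \<le> l" if "facewise_lipschitz \<phi>" for \<phi>
    using facewise_lipschitz_le_length[OF that g(1,2) refl refl]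
    by (simp add: g(3,4)) (metis dual_order.trans ereal_less_eq(3))
  have "pathstart g \<in> sup_sphere" "pathfinish g \<in> sup_sphere"
    using g(2) by (auto simp: subset_iff)
  then have b: "\<bar>a\<^sub>y\<bar> \<le> 1" "\<bar>a\<^sub>z\<bar> \<le> 1" "\<bar>b\<^sub>x\<bar> \<le> 1" "\<bar>b\<^sub>z\<bar> \<le> 1"
    using g(3,4) sup_sphere_component_le[of "pathstart g" 2] sup_sphere_component_le[of "pathstart g" 3]
      sup_sphere_component_le[of "pathfinish g" 1] sup_sphere_component_le[of "pathfinish g" 3]
    by auto
  then have I: "a\<^sub>y \<in> {-1..1}" "a\<^sub>z \<in> {-1..1}" "b\<^sub>x \<in> {-1..1}" "b\<^sub>z \<in> {-1..1}"
      "- a\<^sub>z \<in> {-1..1}" "- b\<^sub>z \<in> {-1..1}"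
    by (simp_all add: abs_le_iff)
  define k where "k = max 0 (a\<^sub>z - a\<^sub>y)"
  have k: "0 \<le> k" "k \<le> 2"
    using b by (auto simp: k_def)
  define k' where "k' = max 0 (- a\<^sub>z - a\<^sub>y)"
  have k': "0 \<le> k'" "k' \<le> 2"
    using b by (auto simp: k'_def)
  \<comment> \<open>The first two bounds are related by exchanging \<open>x\<close> and \<open>y\<close>, which also exchanges the two ends
      of the path, and the next two by reflection in \<open>z\<close>.\<close>
  have "2 - b\<^sub>x - max a\<^sub>y \<bar>a\<^sub>z\<bar> \<le> l"
    using le[OF facewise_lipschitz_exit_pot] unfolding exit_pot_faces(1) exit_pot_faces(3)[OF I(3,4)]
    by linarith
  moreover have "2 - a\<^sub>y - max b\<^sub>x \<bar>b\<^sub>z\<bar> \<le> l"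
    using le[OF facewise_lipschitz_swap[OF facewise_lipschitz_exit_pot]]
    unfolding exit_pot_faces(1) exit_pot_faces(3)[OF I(1,2)]
    by linarith
  moreover have "min (2 - max a\<^sub>y a\<^sub>z - b\<^sub>x) (2 - a\<^sub>y + b\<^sub>z) \<le> l"
    using le[OF facewise_lipschitz_mixed_pot[OF k]]
    unfolding mixed_pot_faces(1)[OF k] mixed_pot_faces(3)[OF k I(3,4)]
    unfolding k_def by linarith
  moreover have "min (2 - max a\<^sub>y (- a\<^sub>z) - b\<^sub>x) (2 - a\<^sub>y - b\<^sub>z) \<le> l"
    using le[OF facewise_lipschitz_reflect[OF facewise_lipschitz_mixed_pot[OF k']]]
    unfolding mixed_pot_faces(1)[OF k'] mixed_pot_faces(3)[OF k' I(3,6)]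
    unfolding k'_def by linarith
  moreover have "\<bar>a\<^sub>z - b\<^sub>z\<bar> \<le> l"
    using le[OF facewise_lipschitz_third] by simp
  ultimately have "max (2 - a\<^sub>y - b\<^sub>x) \<bar>a\<^sub>z - b\<^sub>z\<bar> \<le> l
     \<or> max (2 - a\<^sub>z - b\<^sub>x) (2 - a\<^sub>y - b\<^sub>z) \<le> l
     \<or> max (2 + a\<^sub>z - b\<^sub>x) (2 - a\<^sub>y + b\<^sub>z) \<le> l"
    by (intro some_max_le_if_bounds)
  then show "ereal (min (max (2 - a\<^sub>y - b\<^sub>x) \<bar>a\<^sub>z - b\<^sub>z\<bar>)
    (min (max (2 - a\<^sub>z - b\<^sub>x) (2 - a\<^sub>y - b\<^sub>z)) (max (2 + a\<^sub>z - b\<^sub>x) (2 - a\<^sub>y + b\<^sub>z)))) \<le> ereal l"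
    by (simp only: ereal_less_eq min_le_iff_disj)
qed

section \<open>Polygonal paths on the sphere\<close>

lemma polygonal_path_ends:
  "path (polygonal_path (p # Cs @ [q])) \<and> pathstart (polygonal_path (p # Cs @ [q])) = p
     \<and> pathfinish (polygonal_path (p # Cs @ [q])) = q"
proof (induction Cs arbitrary: p)
  case (Cons r Cs)
  then show ?case
    by (cases Cs) auto
qed auto

lemma closed_segment_subset_sup_sphere:
  fixes p q :: "real ^ 'n"
  assumes "p \<in> sup_sphere" "q \<in> sup_sphere" "p $ i = s" "q $ i = s" "\<bar>s\<bar> = 1"
  shows "closed_segment p q \<subseteq> sup_sphere"
proof
  fix x assume "x \<in> closed_segment p q"
  then obtain t where t: "0 \<le> t" "t \<le> 1" "x = (1 - t) *\<^sub>R p + t *\<^sub>R q"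
    by (auto simp: in_segment)
  have "infnorm x \<le> (1 - t) * infnorm p + t * infnorm q"
    using infnorm_triangle[of "(1 - t) *\<^sub>R p" "t *\<^sub>R q"] t by (simp add: infnorm_mul)
  moreover have "x $ i = s"
    by (simp add: t(3) assms left_diff_distrib)
  ultimately show "x \<in> sup_sphere"
    using assms(1,2,5) component_le_infnorm_cart[of x i] by (simp add: sup_sphere_def)
qed

text \<open>A facet is a face of the cube in the sense of convexity, so it meets a segment between two
  points of the sphere in the convex hull of those endpoints that it contains.\<close>

lemma closed_segment_Int_face:
  fixes p q :: "real ^ 'n"
  assumes "p \<in> sup_sphere" "q \<in> sup_sphere" "s = 1 \<or> s = -1"
  shows "closed_segment p q \<inter> {x. x $ i = s} =
    (if p $ i = s then if q $ i = s then closed_segment p q else {p}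
     else if q $ i = s then {q} else {})"
proof -
  have le: "\<bar>p $ i\<bar> \<le> 1" "\<bar>q $ i\<bar> \<le> 1"
    using assms component_le_infnorm_cart[of p i] component_le_infnorm_cart[of q i]
    by (auto simp: sup_sphere_def)
  have *: "s - x $ i = (1 - t) * (s - p $ i) + t * (s - q $ i)"
    if "x = (1 - t) *\<^sub>R p + t *\<^sub>R q" for x t
    by (simp add: that algebra_simps)
  have endpoint: "(p $ i = s \<or> x = q) \<and> (q $ i = s \<or> x = p)"
    if "x \<in> closed_segment p q" and xs: "x $ i = s" for x
  proof -
    obtain t where t: "0 \<le> t" "t \<le> 1" and x: "x = (1 - t) *\<^sub>R p + t *\<^sub>R q"
      using \<open>x \<in> closed_segment p q\<close> by (auto simp: in_segment)
    have sum: "(1 - t) * (s - p $ i) + t * (s - q $ i) = 0"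
      using *[OF x] xs by simp
    have "(1 - t) * (s - p $ i) = 0 \<and> t * (s - q $ i) = 0"
      using assms(3)
    proof
      assume "s = 1"
      then have "0 \<le> (1 - t) * (s - p $ i)" "0 \<le> t * (s - q $ i)"
        using t le by (auto simp: abs_le_iff)
      then show ?thesis
        using sum by linarith
    next
      assume "s = -1"
      then have "(1 - t) * (s - p $ i) \<le> 0" "t * (s - q $ i) \<le> 0"
        using t le by (auto simp: abs_le_iff mult_nonneg_nonpos)
      then show ?thesis
        using sum by linarith
    qed
    then have "(p $ i = s \<or> t = 1) \<and> (q $ i = s \<or> t = 0)"
      by auto
    then show ?thesis
      using x by auto
  qed
  have whole: "x $ i = s" if "p $ i = s" "q $ i = s" "x \<in> closed_segment p q" for x
    using * that by (auto simp: in_segment)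
  show ?thesis
  proof (cases "p $ i = s"; cases "q $ i = s")
    assume pq: "p $ i = s" "q $ i \<noteq> s"
    then have "closed_segment p q \<inter> {x. x $ i = s} = {p}"
      by (intro equalityI subsetI) (use endpoint in auto)
    then show ?thesis
      using pq by simp
  next
    assume pq: "p $ i \<noteq> s" "q $ i = s"
    then have "closed_segment p q \<inter> {x. x $ i = s} = {q}"
      by (intro equalityI subsetI) (use endpoint in auto)
    then show ?thesis
      using pq by simp
  next
    assume pq: "p $ i = s" "q $ i = s"
    then have "closed_segment p q \<inter> {x. x $ i = s} = closed_segment p q"
      using whole by auto
    then show ?thesis
      using pq by simp
  next
    assume pq: "p $ i \<noteq> s" "q $ i \<noteq> s"
    then have "closed_segment p q \<inter> {x. x $ i = s} = {}"
      using endpoint by auto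
    then show ?thesis
      using pq by simp
  qed
qed

lemma singleton_eq_segment: "\<exists>p q. {x :: real ^ 'n} = closed_segment p q"
  using closed_segment_idem[of x] by metis

lemma facetE:
  assumes "F \<in> facets"
  obtains i s where "F = sup_sphere \<inter> {x. x $ i = s}" "s = 1 \<or> s = -1"
proof -
  obtain i s where "F = {x \<in> sup_sphere. x $ i = s}" "s \<in> {1, -1}"
    using assms unfolding facets_def by blast
  then show thesis
    using that[of i s] by auto
qed

lemma in_ridge:
  assumes "x \<in> sup_sphere" "i \<noteq> j" "\<bar>x $ i\<bar> = 1" "\<bar>x $ j\<bar> = 1"
  shows "\<exists>E\<in>ridges. x \<in> E"
proof
  have "x $ i \<in> {1, -1}" "x $ j \<in> {1, -1}"
    using assms(3,4) by (simp_all add: abs_eq_iff')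
  then show "{y \<in> sup_sphere. y $ i = x $ i \<and> y $ j = x $ j} \<in> ridges"
    unfolding ridges_def using assms(2) by blast
qed (use assms(1) in simp)

lemma planar_pathI:
  fixes g :: "real \<Rightarrow> real ^ 3"
  assumes "path_image g \<subseteq> convex hull V"
    and "\<And>x. x \<in> V \<Longrightarrow> k * x $ 1 + l * x $ 2 + m * x $ 3 = d"
    and "k \<noteq> 0 \<or> l \<noteq> 0 \<or> m \<noteq> 0"
  shows "planar_path g"
proof -
  define n :: "real ^ 3" where "n = vector [k, l, m]"
  have n: "n \<bullet> x = k * x $ 1 + l * x $ 2 + m * x $ 3" for x
    by (simp add: n_def inner_vec_def sum_3)
  have "n \<noteq> 0"
    using assms(3) by (auto simp: n_def vec_eq_iff forall_3)
  then have "aff_dim {x. n \<bullet> x = d} = int CARD(3) - 1"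
    by simp
  moreover have "convex hull V \<subseteq> {x. n \<bullet> x = d}"
    using assms(2) by (intro hull_minimal convex_hyperplane) (auto simp: n)
  ultimately show ?thesis
    unfolding planar_path_def using assms(1)
    by (intro exI[of _ "{x. n \<bullet> x = d}"] conjI affine_hyperplane order_trans[OF assms(1)])
qed

lemma segmental_path_linepath:
  fixes A B :: "real ^ 'n"
  assumes "A \<in> sup_sphere" "B \<in> sup_sphere" "A $ i = s" "B $ i = s" "\<bar>s\<bar> = 1"
  shows "segmental_path A B (linepath A B)"
  unfolding segmental_path_def
proof (intro conjI ballI)
  show "path_image (linepath A B) \<subseteq> sup_sphere"
    using closed_segment_subset_sup_sphere[OF assms] by simp
  then show "path_image (linepath A B) \<inter> F = {} \<or> (\<exists>p q. path_image (linepath A B) \<inter> F = closed_segment p q)"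
    if F_facet: "F \<in> facets" for F
  proof -
    obtain j t where F: "F = sup_sphere \<inter> {x. x $ j = t}" and t: "t = 1 \<or> t = -1"
      by (rule facetE[OF F_facet])
    have "path_image (linepath A B) \<inter> F = closed_segment A B \<inter> {x. x $ j = t}"
      using closed_segment_subset_sup_sphere[OF assms] F by auto
    then show ?thesis
      unfolding closed_segment_Int_face[OF assms(1,2) t]
      by (auto simp: singleton_eq_segment)
  qed
qed (auto intro!: exI[of _ "[]"])

text \<open>The flags \<open>a\<close>, \<open>c\<close>, \<open>d\<close>, \<open>b\<close> record which of the successive vertices \<open>A\<close>, \<open>C\<close>, \<open>D\<close>, \<open>B\<close> lie in a given facet.
  If vertices that are not neighbours share a facet only when an edge between them degenerates, the path meets the
  facet in at most one segment.\<close>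

lemma three_segments_face:
  fixes A B C D :: "real ^ 'n"
  assumes "a \<Longrightarrow> d \<Longrightarrow> A = C" "c \<Longrightarrow> b \<Longrightarrow> B = D" "a \<Longrightarrow> b \<Longrightarrow> A = C \<and> B = D"
    "A = C \<Longrightarrow> a = c" "B = D \<Longrightarrow> b = d"
  shows "(if a then if c then closed_segment A C else {A} else if c then {C} else {})
     \<union> (if c then if d then closed_segment C D else {C} else if d then {D} else {})
     \<union> (if d then if b then closed_segment D B else {D} else if b then {B} else {})
   \<in> {{}, {A}, {C}, {D}, {B}, closed_segment A C, closed_segment C D, closed_segment D B}"
proof -
  have insert: "insert X (closed_segment X Y) = closed_segment X Y"
     "insert Y (closed_segment X Y) = closed_segment X Y" for X Y :: "real ^ 'n"
    by auto
  consider "a" "d" "A = C" "c" "b" "B = D" | "a" "d" "A = C" "c" "\<not> b" | "a" "\<not> d" "\<not> b" 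
    | "\<not> a" "b" "c" "B = D" "d"| "\<not> a" "b" "\<not> c"| "\<not> a" "\<not> b"
    using assms by blast
  then show ?thesis
    by cases (simp_all add: insert)
qed

lemma segmental_path_via_two:
  fixes A B C D :: "real ^ 'n"
  assumes sphere: "A \<in> sup_sphere" "C \<in> sup_sphere" "D \<in> sup_sphere" "B \<in> sup_sphere"
    and facets: "A $ i = s" "C $ i = s" "C $ j = t" "D $ j = t" "D $ k = u" "B $ k = u"
      "\<bar>s\<bar> = 1" "\<bar>t\<bar> = 1" "\<bar>u\<bar> = 1"
    and ridges: "i \<noteq> j" "j \<noteq> k"
    and AD: "\<And>l r. A $ l = r \<Longrightarrow> D $ l = r \<Longrightarrow> r = 1 \<or> r = -1 \<Longrightarrow> A = C"
    and CB: "\<And>l r. C $ l = r \<Longrightarrow> B $ l = r \<Longrightarrow> r = 1 \<or> r = -1 \<Longrightarrow> B = D"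
    and AB: "\<And>l r. A $ l = r \<Longrightarrow> B $ l = r \<Longrightarrow> r = 1 \<or> r = -1 \<Longrightarrow> A = C \<and> B = D"
  shows "segmental_path A B (polygonal_path [A, C, D, B])"
  unfolding segmental_path_def
proof (intro conjI ballI exI[of _ "[C, D]"])
  let ?I = "closed_segment A C \<union> closed_segment C D \<union> closed_segment D B"
  have image: "path_image (polygonal_path [A, C, D, B]) = ?I"
    by (simp add: path_image_join Un_assoc)
  have sub: "?I \<subseteq> sup_sphere"
    by (intro Un_least closed_segment_subset_sup_sphere[OF _ _ facets(1,2)]
        closed_segment_subset_sup_sphere[OF _ _ facets(3,4)]
        closed_segment_subset_sup_sphere[OF _ _ facets(5,6)] sphere facets)
  then show "path_image (polygonal_path [A, C, D, B]) \<subseteq> sup_sphere"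
    by (simp only: image)
  show "polygonal_path [A, C, D, B] = polygonal_path (A # [C, D] @ [B])"
    by simp
  show "\<exists>E\<in>ridges. X \<in> E" if "X \<in> set [C, D]" for X
    using that in_ridge[of C i j] in_ridge[of D j k] sphere(2,3) facets ridges by fastforce
  fix F :: "(real ^ 'n) set" assume "F \<in> facets"
  then obtain l r where F: "F = sup_sphere \<inter> {x. x $ l = r}" and r: "r = 1 \<or> r = -1"
    by (rule facetE)
  have "path_image (polygonal_path [A, C, D, B]) \<inter> F = ?I \<inter> {x. x $ l = r}"
    using sub F by (auto simp only: image)
  also have "\<dots> = closed_segment A C \<inter> {x. x $ l = r} \<union> closed_segment C D \<inter> {x. x $ l = r} \<union>
      closed_segment D B \<inter> {x. x $ l = r}"
    by blast
  finally have eq: "path_image (polygonal_path [A, C, D, B]) \<inter> F = \<dots>" .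
  have segs: "path_image (polygonal_path [A, C, D, B]) \<inter> F \<in>
      {{}, {A}, {C}, {D}, {B}, closed_segment A C, closed_segment C D, closed_segment D B}"
    unfolding eq closed_segment_Int_face[OF sphere(1,2) r] closed_segment_Int_face[OF sphere(2,3) r]
      closed_segment_Int_face[OF sphere(3,4) r]
    by (rule three_segments_face) (use AD CB AB r in blast)+
  show "path_image (polygonal_path [A, C, D, B]) \<inter> F = {} \<or>
      (\<exists>p q. path_image (polygonal_path [A, C, D, B]) \<inter> F = closed_segment p q)"
    using segs singleton_eq_segment by (elim insertE emptyE; simp) blast+
qed

lemma segmental_path_via_one:
  fixes A B C :: "real ^ 'n"
  assumes sphere: "A \<in> sup_sphere" "C \<in> sup_sphere" "B \<in> sup_sphere"
    and facets: "A $ i = s" "C $ i = s" "C $ j = t" "B $ j = t" "\<bar>s\<bar> = 1" "\<bar>t\<bar> = 1"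
    and ridge: "i \<noteq> j"
    and AB: "\<And>l r. A $ l = r \<Longrightarrow> B $ l = r \<Longrightarrow> r \<noteq> 1 \<and> r \<noteq> -1"
  shows "segmental_path A B (polygonal_path [A, C, B])"
  unfolding segmental_path_def
proof (intro conjI ballI exI[of _ "[C]"])
  let ?I = "closed_segment A C \<union> closed_segment C B"
  have image: "path_image (polygonal_path [A, C, B]) = ?I"
    by (simp add: path_image_join)
  have sub: "?I \<subseteq> sup_sphere"
    by (intro Un_least closed_segment_subset_sup_sphere[OF _ _ facets(1,2)]
        closed_segment_subset_sup_sphere[OF _ _ facets(3,4)] sphere facets)
  then show "path_image (polygonal_path [A, C, B]) \<subseteq> sup_sphere"
    by (simp only: image)
  show "polygonal_path [A, C, B] = polygonal_path (A # [C] @ [B])"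
    by simp
  show "\<exists>E\<in>ridges. X \<in> E" if "X \<in> set [C]" for X
    using that in_ridge[of C i j] sphere(2) facets ridge by fastforce
  fix F :: "(real ^ 'n) set" assume "F \<in> facets"
  then obtain l r where F: "F = sup_sphere \<inter> {x. x $ l = r}" and r: "r = 1 \<or> r = -1"
    by (rule facetE)
  have "path_image (polygonal_path [A, C, B]) \<inter> F = ?I \<inter> {x. x $ l = r}"
    using sub F by (auto simp only: image)
  also have "\<dots> = closed_segment A C \<inter> {x. x $ l = r} \<union> closed_segment C B \<inter> {x. x $ l = r}"
    by blast
  finally have eq: "path_image (polygonal_path [A, C, B]) \<inter> F = \<dots>" .
  have insert: "insert X (closed_segment X Y) = closed_segment X Y"
     "insert Y (closed_segment X Y) = closed_segment X Y" for X Y :: "real ^ 'n"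
    by auto
  show "path_image (polygonal_path [A, C, B]) \<inter> F = {} \<or>
      (\<exists>p q. path_image (polygonal_path [A, C, B]) \<inter> F = closed_segment p q)"
    unfolding eq closed_segment_Int_face[OF sphere(1,2) r] closed_segment_Int_face[OF sphere(2,3) r]
    using AB[of l r] r
    by (cases "A $ l = r"; cases "C $ l = r"; cases "B $ l = r") (auto simp: singleton_eq_segment insert)
qed

section \<open>Planar paths through two or three facets\<close>

lemma sup_sphere_3: "x \<in> sup_sphere \<longleftrightarrow> max \<bar>x $ 1\<bar> (max \<bar>x $ 2\<bar> \<bar>x $ 3\<bar>) = 1" for x :: "real ^ 3"
  by (simp add: sup_sphere_def infnorm_3)

lemma planar_path_straight:
  fixes A B :: "real ^ 3"
  assumes "A \<in> sup_sphere" "B \<in> sup_sphere" "A $ i = 1" "B $ i = 1"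
  shows "\<exists>g. segmental_path A B g \<and> planar_path g \<and> length_bounded g (infnorm (B - A))"
proof (intro exI conjI)
  show "segmental_path A B (linepath A B)"
    using assms by (intro segmental_path_linepath[of A B i 1]) auto
  show "planar_path (linepath A B)"
  proof (rule planar_pathI[of _ "{A, B}" "of_bool (i = 1)" "of_bool (i = 2)" "of_bool (i = 3)" 1])
    show "of_bool (i = 1) * x $ 1 + of_bool (i = 2) * x $ 2 + of_bool (i = 3) * x $ 3 = 1"
      if "x \<in> {A, B}" for x
      using that assms(3,4) exhaust_3[of i] by auto
  qed (use exhaust_3[of i] in \<open>auto simp: segment_convex_hull\<close>)
  show "length_bounded (linepath A B) (infnorm (B - A))"
    by (rule length_bounded_linepath)
qed

text \<open>Unfolding the facets \<open>x = 1\<close> and \<open>y = 1\<close> into a plane, the path is the straight segment between the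
  two points. If both points lie on the same facet \<open>z = 1\<close> or \<open>z = -1\<close>, the whole path does and bends in it, which
  is not allowed; hence the last two assumptions.\<close>

lemma planar_path_two_facets:
  fixes p q y z :: real
  assumes p: "0 < p" "p \<le> 2" and q: "0 < q" "q \<le> 2" and "\<bar>y\<bar> \<le> 1" "\<bar>z\<bar> \<le> 1"
    and not_face: "\<not> (y = 1 \<and> z = 1)" "\<not> (y = -1 \<and> z = -1)"
  defines "A \<equiv> vector [1, 1 - p, y] :: real ^ 3" and "B \<equiv> vector [1 - q, 1, z] :: real ^ 3"
  shows "\<exists>g. segmental_path A B g \<and> planar_path g \<and> length_bounded g (max (p + q) \<bar>y - z\<bar>)"
proof (intro exI conjI)
  define m where "m = (z - y) / (p + q)"
  have z: "z = y + p * m + q * m"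
  proof -
    have "m * (p + q) = z - y"
      using p q by (simp add: m_def)
    then show ?thesis
      by (simp add: algebra_simps)
  qed
  define C :: "real ^ 3" where "C = vector [1, 1, y + p * m]"
  let ?g = "polygonal_path [A, C, B]"
  have "y + p * m = (q * y + p * z) / (p + q)"
    using p q by (simp add: m_def field_simps)
  moreover have "\<bar>q * y + p * z\<bar> \<le> q * 1 + p * 1"
    using assms(5,6) p q
    by (intro order_trans[OF abs_triangle_ineq] add_mono) (auto simp: abs_mult intro!: mult_left_le)
  ultimately have "\<bar>y + p * m\<bar> \<le> 1"
    using p q by simp
  then have sphere: "A \<in> sup_sphere" "C \<in> sup_sphere" "B \<in> sup_sphere"
    using p q assms(5,6) by (auto simp: sup_sphere_3 A_def B_def C_def)
  show "segmental_path A B ?g"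
  proof (rule segmental_path_via_one[of _ _ _ 1 1 2 1])
    fix l :: 3 and r :: real
    assume "A $ l = r" "B $ l = r"
    then show "r \<noteq> 1 \<and> r \<noteq> -1"
      using exhaust_3[of l] p q not_face by (auto simp: A_def B_def)
  qed (use sphere in \<open>auto simp: A_def B_def C_def\<close>)
  show "planar_path ?g"
  proof (rule planar_pathI[of _ "{A, C, B}" m "- m" 1 "y + p * m"])
    show "path_image ?g \<subseteq> convex hull {A, C, B}"
      by (simp add: path_image_join segment_convex_hull hull_mono)
    show "m * x $ 1 + - m * x $ 2 + 1 * x $ 3 = y + p * m" if "x \<in> {A, C, B}" for x
      using that z by (auto simp: A_def B_def C_def algebra_simps)
  qed simp
  have "infnorm (C - A) = p * max 1 \<bar>m\<bar>" "infnorm (B - C) = q * max 1 \<bar>m\<bar>"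
    using p q z by (simp_all add: infnorm_3 A_def B_def C_def abs_mult max_mult_distrib_left)
  moreover have "(p + q) * max 1 \<bar>m\<bar> = max (p + q) \<bar>y - z\<bar>"
    using p q by (simp add: max_mult_distrib_left m_def abs_minus_commute)
  ultimately have "infnorm (C - A) + infnorm (B - C) = max (p + q) \<bar>y - z\<bar>"
    by (simp add: distrib_right)
  then show "length_bounded ?g (max (p + q) \<bar>y - z\<bar>)"
    using length_bounded_join[OF length_bounded_linepath[of A C] length_bounded_linepath[of C B]]
    by simp
qed

text \<open>A path through the facets \<open>x = 1\<close>, \<open>z = e\<close>, \<open>y = 1\<close>, crossing ridges at \<open>(1, 1 - S, e)\<close> and \<open>(1 - T, 1, e)\<close>. The numbers
  \<open>p\<close> and \<open>u\<close> are the distances of the first endpoint from the ridges \<open>x = y = 1\<close> and \<open>x = 1, z = e\<close>;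
  \<open>q\<close> and \<open>v\<close> are the corresponding ones of the second endpoint. The plane of the path has the
  normal vector \<open>(S, T, - e * w)\<close>; the equations for \<open>w\<close> say that it contains the endpoints.\<close>

lemma planar_path_three_facets:
  fixes e p q u v S T w :: real
  assumes e: "e = 1 \<or> e = -1" and p: "p \<le> 2" and q: "q \<le> 2"
    and u: "0 \<le> u" "u < p" and v: "0 \<le> v" "v < q"
    and S: "0 < S" "S \<le> p" "S = p \<longleftrightarrow> u = 0"
    and T: "0 < T" "T \<le> q" "T = q \<longleftrightarrow> v = 0"
    and w: "w * u = T * (p - S)" "w * v = S * (q - T)"
  defines "A \<equiv> vector [1, 1 - p, e * (1 - u)] :: real ^ 3"
    and "B \<equiv> vector [1 - q, 1, e * (1 - v)] :: real ^ 3"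
  shows "\<exists>g. segmental_path A B g \<and> planar_path g
    \<and> length_bounded g (max (p - S) u + max S T + max (q - T) v)"
proof (intro exI conjI)
  define C :: "real ^ 3" where "C = vector [1, 1 - S, e]"
  define D :: "real ^ 3" where "D = vector [1 - T, 1, e]"
  let ?g = "polygonal_path [A, C, D, B]"
  note vecs = A_def B_def C_def D_def
  have sphere: "A \<in> sup_sphere" "C \<in> sup_sphere" "D \<in> sup_sphere" "B \<in> sup_sphere"
    using e p q u v S T by (auto simp: sup_sphere_3 vecs)
  show "segmental_path A B ?g"
  proof (rule segmental_path_via_two[of _ _ _ _ 1 1 3 e 2 1])
    fix l :: 3 and r :: real
    assume r: "r = 1 \<or> r = -1"
    show "A = C" if "A $ l = r" "D $ l = r"
      using exhaust_3[of l] that r e p q u v S T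
      by (elim disjE) (auto simp: vecs)
    show "B = D" if "C $ l = r" "B $ l = r"
      using exhaust_3[of l] that r e p q u v S T
      by (elim disjE) (auto simp: vecs)
    show "A = C \<and> B = D" if "A $ l = r" "B $ l = r"
      using exhaust_3[of l] that r e p q u v S T
      by (elim disjE) (auto simp: vecs)
  qed (use sphere e in \<open>auto simp: vecs\<close>)
  show "planar_path ?g"
  proof (rule planar_pathI[of _ "{A, C, D, B}" S T "- e * w" "S + T - S * T - w"])
    show "path_image ?g \<subseteq> convex hull {A, C, D, B}"
      by (simp add: path_image_join segment_convex_hull hull_mono)
    show "S * x $ 1 + T * x $ 2 + - e * w * x $ 3 = S + T - S * T - w" if "x \<in> {A, C, D, B}" for x
      using that w e by (elim insertE emptyE disjE) (simp_all add: vecs algebra_simps)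
  qed (use S in simp)
  have "infnorm (C - A) = max (p - S) u" "infnorm (D - C) = max S T" "infnorm (B - D) = max (q - T) v"
    using u v S T e by (auto simp: infnorm_3 vecs)
  then show "length_bounded ?g (max (p - S) u + max S T + max (q - T) v)"
    using length_bounded_join[OF length_bounded_linepath[of A C]
        length_bounded_join[OF length_bounded_linepath[of C D] length_bounded_linepath[of D B]]]
    by (simp add: add.assoc)
qed

text \<open>Coplanarity is one equation for \<open>S\<close> and \<open>T\<close>. If \<open>u + q\<close> is the larger term, a path of that length
  satisfies \<open>T \<le> q - v\<close>, since its three parts are at least \<open>u\<close>, \<open>T\<close> and \<open>v\<close>. With \<open>T = q - v\<close> the
  equation becomes linear in \<open>S\<close>, and \<open>w = S\<close>. The other case is symmetric.\<close>

lemma planar_path_three_facets_length: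
  fixes e p q u v :: real
  assumes e: "e = 1 \<or> e = -1" and p: "p \<le> 2" and q: "q \<le> 2"
    and u: "0 \<le> u" "u < p" and v: "0 \<le> v" "v < q"
  shows "\<exists>g. segmental_path (vector [1, 1 - p, e * (1 - u)] :: real ^ 3) (vector [1 - q, 1, e * (1 - v)]) g
    \<and> planar_path g \<and> length_bounded g (max (u + q) (p + v))"
proof (cases "p - u \<le> q - v")
  case True
  define T where "T = q - v"
  define S where "S = p * T / (T + u)"
  have T: "0 < T" "T \<le> q" "T = q \<longleftrightarrow> v = 0" "p - u \<le> T"
    using v True by (auto simp: T_def)
  have ST: "S * (T + u) = p * T"
    using T u by (simp add: S_def)
  have S: "0 < S" "S \<le> p" "S = p \<longleftrightarrow> u = 0" "S \<le> T" "p - S \<le> u"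
    using T u mult_left_mono[of p "T + u" T] mult_left_mono[of p "T + u" u]
    by (auto simp: S_def field_simps)
  have "max (p - S) u + max S T + max (q - T) v = max (u + q) (p + v)"
    using S T True by (simp add: T_def)
  moreover have "S * u = T * (p - S)" "S * v = S * (q - T)"
    using ST by (auto simp: T_def algebra_simps)
  ultimately show ?thesis
    using planar_path_three_facets[OF e p q u v S(1-3) T(1-3)] by metis
next
  case False
  define S where "S = p - u"
  define T where "T = q * S / (S + v)"
  have S: "0 < S" "S \<le> p" "S = p \<longleftrightarrow> u = 0" "q - v \<le> S"
    using u False by (auto simp: S_def)
  have ST: "T * (S + v) = q * S"
    using S v by (simp add: T_def)
  have T: "0 < T" "T \<le> q" "T = q \<longleftrightarrow> v = 0" "T \<le> S" "q - T \<le> v"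
    using S v mult_left_mono[of q "S + v" S] mult_left_mono[of q "S + v" v]
    by (auto simp: T_def field_simps)
  have "max (p - S) u + max S T + max (q - T) v = max (u + q) (p + v)"
    using S T False by (simp add: S_def)
  moreover have "T * u = T * (p - S)" "T * v = S * (q - T)"
    using ST by (auto simp: S_def algebra_simps)
  ultimately show ?thesis
    using planar_path_three_facets[OF e p q u v S(1-3) T(1-3)] by metis
qed

section \<open>Comparison of the three quantities\<close>

lemma alpha_least_iff:
  fixes a\<^sub>y a\<^sub>z b\<^sub>x b\<^sub>z :: real
  assumes "\<bar>a\<^sub>y\<bar> \<le> 1" "\<bar>a\<^sub>z\<bar> \<le> 1" "\<bar>b\<^sub>x\<bar> \<le> 1" "\<bar>b\<^sub>z\<bar> \<le> 1"
  defines "\<alpha> \<equiv> max (2 - a\<^sub>y - b\<^sub>x) \<bar>a\<^sub>z - b\<^sub>z\<bar>"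
    and "\<beta> \<equiv> max (2 - a\<^sub>z - b\<^sub>x) (2 - a\<^sub>y - b\<^sub>z)"
    and "\<gamma> \<equiv> max (2 + a\<^sub>z - b\<^sub>x) (2 - a\<^sub>y + b\<^sub>z)"
  shows "\<alpha> \<le> \<beta> \<and> \<alpha> \<le> \<gamma> \<longleftrightarrow>
          \<bar>a\<^sub>z\<bar> \<le> a\<^sub>y
        \<or> \<bar>b\<^sub>z\<bar> \<le> b\<^sub>x
        \<or> (\<bar>a\<^sub>y\<bar> \<le> a\<^sub>z \<and> \<bar>b\<^sub>x\<bar> \<le> - b\<^sub>z)
        \<or> (\<bar>a\<^sub>y\<bar> \<le> - a\<^sub>z \<and> \<bar>b\<^sub>x\<bar> \<le> b\<^sub>z)"
  unfolding \<alpha>_def \<beta>_def \<gamma>_def using assms(1-4) by (smt (verit))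

lemma beta_least_iff:
  fixes a\<^sub>y a\<^sub>z b\<^sub>x b\<^sub>z :: real
  assumes "\<bar>a\<^sub>y\<bar> \<le> 1" "\<bar>a\<^sub>z\<bar> \<le> 1" "\<bar>b\<^sub>x\<bar> \<le> 1" "\<bar>b\<^sub>z\<bar> \<le> 1"
  defines "\<alpha> \<equiv> max (2 - a\<^sub>y - b\<^sub>x) \<bar>a\<^sub>z - b\<^sub>z\<bar>"
    and "\<beta> \<equiv> max (2 - a\<^sub>z - b\<^sub>x) (2 - a\<^sub>y - b\<^sub>z)"
    and "\<gamma> \<equiv> max (2 + a\<^sub>z - b\<^sub>x) (2 - a\<^sub>y + b\<^sub>z)"
  shows "\<beta> \<le> \<alpha> \<and> \<beta> \<le> \<gamma> \<longleftrightarrow>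
          (a\<^sub>y \<le> a\<^sub>z \<and> b\<^sub>x \<le> b\<^sub>z \<and> a\<^sub>z \<ge> 0 \<and> b\<^sub>x \<le> a\<^sub>y + a\<^sub>z + b\<^sub>z)
        \<or> (a\<^sub>y \<le> a\<^sub>z \<and> b\<^sub>x \<le> b\<^sub>z \<and> b\<^sub>z \<ge> 0 \<and> a\<^sub>y \<le> b\<^sub>x + a\<^sub>z + b\<^sub>z)
        \<or> (a\<^sub>y = 1 \<and> a\<^sub>z = 1)
        \<or> (b\<^sub>x = 1 \<and> b\<^sub>z = 1)"
  unfolding \<alpha>_def \<beta>_def \<gamma>_def using assms(1-4) by (smt (verit))

lemma gamma_least_iff:
  fixes a\<^sub>y a\<^sub>z b\<^sub>x b\<^sub>z :: real
  assumes "\<bar>a\<^sub>y\<bar> \<le> 1" "\<bar>a\<^sub>z\<bar> \<le> 1" "\<bar>b\<^sub>x\<bar> \<le> 1" "\<bar>b\<^sub>z\<bar> \<le> 1"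
  defines "\<alpha> \<equiv> max (2 - a\<^sub>y - b\<^sub>x) \<bar>a\<^sub>z - b\<^sub>z\<bar>"
    and "\<beta> \<equiv> max (2 - a\<^sub>z - b\<^sub>x) (2 - a\<^sub>y - b\<^sub>z)"
    and "\<gamma> \<equiv> max (2 + a\<^sub>z - b\<^sub>x) (2 - a\<^sub>y + b\<^sub>z)"
  shows "\<gamma> \<le> \<alpha> \<and> \<gamma> \<le> \<beta> \<longleftrightarrow>
          (a\<^sub>y \<le> - a\<^sub>z \<and> b\<^sub>x \<le> - b\<^sub>z \<and> a\<^sub>z \<le> 0 \<and> b\<^sub>x \<le> a\<^sub>y - a\<^sub>z - b\<^sub>z)
        \<or> (a\<^sub>y \<le> - a\<^sub>z \<and> b\<^sub>x \<le> - b\<^sub>z \<and> b\<^sub>z \<le> 0 \<and> a\<^sub>y \<le> b\<^sub>x - a\<^sub>z - b\<^sub>z)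
        \<or> (a\<^sub>y = 1 \<and> - a\<^sub>z = 1)
        \<or> (b\<^sub>x = 1 \<and> - b\<^sub>z = 1)"
  unfolding \<alpha>_def \<beta>_def \<gamma>_def using assms(1-4) by (smt (verit))

section \<open>Distance and planar minimal paths\<close>

theorem theorem1:
  fixes A B :: "real ^ 3" and a\<^sub>y a\<^sub>z b\<^sub>x b\<^sub>z \<alpha> \<beta> \<gamma> :: real
  assumes A: "A = vector [1, a\<^sub>y, a\<^sub>z]" "A \<in> sup_sphere"
    and B: "B = vector [b\<^sub>x, 1, b\<^sub>z]" "B \<in> sup_sphere"
    and alpha: "\<alpha> = max (2 - a\<^sub>y - b\<^sub>x) \<bar>a\<^sub>z - b\<^sub>z\<bar>"
    and beta: "\<beta> = max (2 - a\<^sub>z - b\<^sub>x) (2 - a\<^sub>y - b\<^sub>z)"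
    and gamma: "\<gamma> = max (2 + a\<^sub>z - b\<^sub>x) (2 - a\<^sub>y + b\<^sub>z)"
  shows "geodesic_dist A B = ereal (Min {\<alpha>, \<beta>, \<gamma>})
    \<and> (Min {\<alpha>, \<beta>, \<gamma>} = \<alpha> \<longleftrightarrow>
          \<bar>a\<^sub>z\<bar> \<le> a\<^sub>y
        \<or> \<bar>b\<^sub>z\<bar> \<le> b\<^sub>x
        \<or> (\<bar>a\<^sub>y\<bar> \<le> a\<^sub>z \<and> \<bar>b\<^sub>x\<bar> \<le> - b\<^sub>z)
        \<or> (\<bar>a\<^sub>y\<bar> \<le> - a\<^sub>z \<and> \<bar>b\<^sub>x\<bar> \<le> b\<^sub>z))
    \<and> (Min {\<alpha>, \<beta>, \<gamma>} = \<beta> \<longleftrightarrow>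
          (a\<^sub>y \<le> a\<^sub>z \<and> b\<^sub>x \<le> b\<^sub>z \<and> a\<^sub>z \<ge> 0 \<and> b\<^sub>x \<le> a\<^sub>y + a\<^sub>z + b\<^sub>z)
        \<or> (a\<^sub>y \<le> a\<^sub>z \<and> b\<^sub>x \<le> b\<^sub>z \<and> b\<^sub>z \<ge> 0 \<and> a\<^sub>y \<le> b\<^sub>x + a\<^sub>z + b\<^sub>z)
        \<or> (a\<^sub>y = 1 \<and> a\<^sub>z = 1)
        \<or> (b\<^sub>x = 1 \<and> b\<^sub>z = 1))
    \<and> (Min {\<alpha>, \<beta>, \<gamma>} = \<gamma> \<longleftrightarrow>
          (a\<^sub>y \<le> - a\<^sub>z \<and> b\<^sub>x \<le> - b\<^sub>z \<and> a\<^sub>z \<le> 0 \<and> b\<^sub>x \<le> a\<^sub>y - a\<^sub>z - b\<^sub>z)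
        \<or> (a\<^sub>y \<le> - a\<^sub>z \<and> b\<^sub>x \<le> - b\<^sub>z \<and> b\<^sub>z \<le> 0 \<and> a\<^sub>y \<le> b\<^sub>x - a\<^sub>z - b\<^sub>z)
        \<or> (a\<^sub>y = 1 \<and> - a\<^sub>z = 1)
        \<or> (b\<^sub>x = 1 \<and> - b\<^sub>z = 1))
    \<and> (\<exists>g. minimal_path A B g \<and> planar_path g)"
proof -
  have sphere: "A \<in> sup_sphere" "B \<in> sup_sphere"
    by fact+
  have b: "\<bar>a\<^sub>y\<bar> \<le> 1" "\<bar>a\<^sub>z\<bar> \<le> 1" "\<bar>b\<^sub>x\<bar> \<le> 1" "\<bar>b\<^sub>z\<bar> \<le> 1"
    using sup_sphere_component_le[OF sphere(1), of 2] sup_sphere_component_le[OF sphere(1), of 3]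
      sup_sphere_component_le[OF sphere(2), of 1] sup_sphere_component_le[OF sphere(2), of 3]
    by (simp_all add: A(1) B(1))
  have Min: "Min {\<alpha>, \<beta>, \<gamma>} = min \<alpha> (min \<beta> \<gamma>)"
    by simp
  have lower: "ereal (min \<alpha> (min \<beta> \<gamma>)) \<le> geodesic_dist A B"
    unfolding geodesic_dist_def alpha beta gamma
    using min_le_sup_length A(1) B(1) by (intro INF_greatest) auto
  have "\<exists>g. segmental_path A B g \<and> planar_path g \<and> length_bounded g (min \<alpha> (min \<beta> \<gamma>))"
  proof -
    consider "\<alpha> \<le> \<beta>" "\<alpha> \<le> \<gamma>" | "\<beta> < \<alpha>" "\<beta> \<le> \<gamma>" | "\<gamma> < \<alpha>" "\<gamma> \<le> \<beta>"
      by linarith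
    then show ?thesis
    proof cases
      case 1
      then have min: "min \<alpha> (min \<beta> \<gamma>) = \<alpha>"
        by simp
      \<comment> \<open>In the first two cases both points lie in a common facet.\<close>
      consider "b\<^sub>x = 1" | "a\<^sub>y = 1" | "a\<^sub>y < 1" "b\<^sub>x < 1"
        using b by linarith
      then show ?thesis
      proof cases
        case 1
        then have "infnorm (B - A) = \<alpha>"
          using b by (simp add: infnorm_3 A(1) B(1) alpha abs_minus_commute)
        then show ?thesis
          using planar_path_straight[OF sphere, of 1] 1 by (simp add: min) (simp add: A(1) B(1))
      next
        case 2
        then have "infnorm (B - A) = \<alpha>"
          using b by (simp add: infnorm_3 A(1) B(1) alpha abs_minus_commute)
        then show ?thesis
          using planar_path_straight[OF sphere, of 2] 2 by (simp add: min) (simp add: A(1) B(1))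
      next
        case 3
        \<comment> \<open>If both points were in the facet \<open>z = 1\<close> or \<open>z = -1\<close>, a segment in it would be shorter than \<open>\<alpha>\<close>.\<close>
        have "\<not> (a\<^sub>z = 1 \<and> b\<^sub>z = 1)" "\<not> (a\<^sub>z = -1 \<and> b\<^sub>z = -1)"
          using 1 3 unfolding alpha beta gamma by auto
        then show ?thesis
          using planar_path_two_facets[of "1 - a\<^sub>y" "1 - b\<^sub>x" a\<^sub>z b\<^sub>z] b 3
          by (simp add: min) (simp add: A(1) B(1) alpha algebra_simps)
      qed
    next
      case 2
      \<comment> \<open>Strictness excludes the degenerate path through the corner \<open>(1, 1, 1)\<close>.\<close>
      have "1 - a\<^sub>z < 1 - a\<^sub>y" "1 - b\<^sub>z < 1 - b\<^sub>x"
        using 2(1) b unfolding alpha beta by linarith+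
      then have "\<exists>g. segmental_path (vector [1, 1 - (1 - a\<^sub>y), 1 * (1 - (1 - a\<^sub>z))] :: real ^ 3)
          (vector [1 - (1 - b\<^sub>x), 1, 1 * (1 - (1 - b\<^sub>z))]) g \<and> planar_path g
          \<and> length_bounded g (max ((1 - a\<^sub>z) + (1 - b\<^sub>x)) ((1 - a\<^sub>y) + (1 - b\<^sub>z)))"
        using b by (intro planar_path_three_facets_length) auto
      moreover have "max ((1 - a\<^sub>z) + (1 - b\<^sub>x)) ((1 - a\<^sub>y) + (1 - b\<^sub>z)) = min \<alpha> (min \<beta> \<gamma>)"
        using 2 unfolding beta by (simp add: algebra_simps)
      ultimately show ?thesis
        by (simp add: A(1) B(1))
    next
      case 3
      have "1 + a\<^sub>z < 1 - a\<^sub>y" "1 + b\<^sub>z < 1 - b\<^sub>x"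
        using 3(1) b unfolding alpha gamma by linarith+
      then have "\<exists>g. segmental_path (vector [1, 1 - (1 - a\<^sub>y), - 1 * (1 - (1 + a\<^sub>z))] :: real ^ 3)
          (vector [1 - (1 - b\<^sub>x), 1, - 1 * (1 - (1 + b\<^sub>z))]) g \<and> planar_path g
          \<and> length_bounded g (max ((1 + a\<^sub>z) + (1 - b\<^sub>x)) ((1 - a\<^sub>y) + (1 + b\<^sub>z)))"
        using b by (intro planar_path_three_facets_length) auto
      moreover have "max ((1 + a\<^sub>z) + (1 - b\<^sub>x)) ((1 - a\<^sub>y) + (1 + b\<^sub>z)) = min \<alpha> (min \<beta> \<gamma>)"
        using 3 unfolding gamma by (simp add: algebra_simps)
      ultimately show ?thesis
        by (simp add: A(1) B(1))
    qed
  qed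
  then obtain g where g: "segmental_path A B g" "planar_path g" "length_bounded g (min \<alpha> (min \<beta> \<gamma>))"
    by blast
  have "geodesic_dist A B \<le> sup_length g"
    using g(1) polygonal_path_ends unfolding geodesic_dist_def segmental_path_def
    by (intro INF_lower) auto
  then have dist: "geodesic_dist A B = ereal (min \<alpha> (min \<beta> \<gamma>))" "sup_length g = geodesic_dist A B"
    using sup_length_le_if_length_bounded[OF g(3)] lower by (meson antisym order_trans)+
  have min_eq: "(min \<alpha> (min \<beta> \<gamma>) = \<alpha>) = (\<alpha> \<le> \<beta> \<and> \<alpha> \<le> \<gamma>)"
    "(min \<alpha> (min \<beta> \<gamma>) = \<beta>) = (\<beta> \<le> \<alpha> \<and> \<beta> \<le> \<gamma>)"
    "(min \<alpha> (min \<beta> \<gamma>) = \<gamma>) = (\<gamma> \<le> \<alpha> \<and> \<gamma> \<le> \<beta>)"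
    by linarith+
  show ?thesis
    unfolding Min min_eq
  proof (intro conjI)
    show "\<exists>g. minimal_path A B g \<and> planar_path g"
      using g dist unfolding minimal_path_def by blast
    show "geodesic_dist A B = ereal (min \<alpha> (min \<beta> \<gamma>))"
      by fact
  qed (rule alpha_least_iff[OF b, folded alpha beta gamma] beta_least_iff[OF b, folded alpha beta gamma]
      gamma_least_iff[OF b, folded alpha beta gamma])+
qed

end
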